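(* Let $M$ be a smooth closed connected oriented $n$-manifold, $n\ge3$. Let $g\in\mathcal M_{-1}$ and let $p\in\mathcal F$ be a solution of $$(n-1)\Delta_g p+p=2\,|\mathrm{Ric}^T(g)|_g^2 .$$ Then $p\ge0$, and more particularly, either (a) $p=0$ (identically on $M$) and $\mathrm{Ric}(g)=-\frac1n g$, or (b) $p>0$ everywhere on $M$ and $\mathrm{Ric}(g)\ne-\frac1n g$.
   Context: $\mathcal F=C^\infty(M,\mathbb R)$; $\mathcal M_{-1}$ is the set of smooth Riemannian metrics $g$ on $M$ with scalar curvature $R(g)=-1$; $\mathrm{Ric}(g)$ is the Ricci tensor and $\mathrm{Ric}^T(g)=\mathrm{Ric}(g)-\frac1nR(g)g$ its traceless part; $|\cdot|_g$ is the pointwise $g$-norm on tensors. $\Delta_g$ is the Laplacian on functions with the positive-operator sign convention, $\Delta_g\phi=-g^{ij}\phi_{|i|j}$ (bar denoting covariant derivative). *)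

theory Defs
  imports "HOL-Analysis.Analysis"
begin

section \<open>Smooth maps between Euclidean spaces\<close>

fun C_k_on :: "nat \<Rightarrow> 'a::real_normed_vector set \<Rightarrow> ('a \<Rightarrow> 'b::real_normed_vector) \<Rightarrow> bool" where
  "C_k_on 0 S f \<longleftrightarrow> continuous_on S f"
| "C_k_on (Suc k) S f \<longleftrightarrow>
     (\<forall>x\<in>S. f differentiable (at x)) \<and>
     (\<forall>v. C_k_on k S (\<lambda>x. frechet_derivative f (at x) v))"

text \<open>This notion is only used for open sets \<^term>\<open>S\<close>.\<close>

definition smooth_on :: "'a::real_normed_vector set \<Rightarrow> ('a \<Rightarrow> 'b::real_normed_vector) \<Rightarrow> bool" where
  "smooth_on S f \<longleftrightarrow> (\<forall>k. C_k_on k S f)"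

definition pderiv_at :: "'n::finite \<Rightarrow> (real^'n \<Rightarrow> real) \<Rightarrow> real^'n \<Rightarrow> real" where
  "pderiv_at i f y = frechet_derivative f (at y) (axis i 1)"


section \<open>Smooth manifolds\<close>

text \<open>A chart is a pair of its domain and its coordinate map.  The dimension of the manifold
  is the cardinality of the index type.\<close>

type_synonym ('m, 'n) chart = "'m set \<times> ('m \<Rightarrow> real^'n)"

definition chart_range :: "('m, 'n::finite) chart \<Rightarrow> (real^'n) set" where
  "chart_range c = snd c ` fst c"

definition chart_inv :: "('m, 'n::finite) chart \<Rightarrow> real^'n \<Rightarrow> 'm" where
  "chart_inv c = inv_into (fst c) (snd c)"

definition is_chart :: "'m topology \<Rightarrow> ('m, 'n::finite) chart \<Rightarrow> bool" where
  "is_chart M c \<longleftrightarrow>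
     openin M (fst c) \<and> open (chart_range c) \<and>
     homeomorphic_map (subtopology M (fst c)) (top_of_set (chart_range c)) (snd c)"

definition overlap :: "('m, 'n::finite) chart \<Rightarrow> ('m, 'n) chart \<Rightarrow> (real^'n) set" where
  "overlap c d = snd c ` (fst c \<inter> fst d)"

definition transition :: "('m, 'n::finite) chart \<Rightarrow> ('m, 'n) chart \<Rightarrow> real^'n \<Rightarrow> real^'n" where
  "transition c d = snd d \<circ> chart_inv c"

text \<open>The atlas need not be maximal.\<close>

definition smooth_manifold :: "'m topology \<Rightarrow> ('m, 'n::finite) chart set \<Rightarrow> bool" where
  "smooth_manifold M A \<longleftrightarrow>
     Hausdorff_space M \<and> second_countable M \<and>
     (\<forall>c\<in>A. is_chart M c) \<and> (\<Union>c\<in>A. fst c) = topspace M \<and>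
     (\<forall>c\<in>A. \<forall>d\<in>A. smooth_on (overlap c d) (transition c d))"

text \<open>An orientation is given by an atlas of positively oriented charts.\<close>

definition oriented_atlas :: "('m, 'n::finite) chart set \<Rightarrow> bool" where
  "oriented_atlas A \<longleftrightarrow>
     (\<forall>c\<in>A. \<forall>d\<in>A. \<forall>y\<in>overlap c d. det (jacobian (transition c d) (at y)) > 0)"

definition in_chart :: "('m, 'n::finite) chart \<Rightarrow> ('m \<Rightarrow> real) \<Rightarrow> real^'n \<Rightarrow> real" where
  "in_chart c f = f \<circ> chart_inv c"

definition smooth_function :: "('m, 'n::finite) chart set \<Rightarrow> ('m \<Rightarrow> real) \<Rightarrow> bool" where
  "smooth_function A f \<longleftrightarrow> (\<forall>c\<in>A. smooth_on (chart_range c) (in_chart c f))"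


section \<open>Riemannian metrics\<close>

text \<open>A covariant 2-tensor field is represented by its component matrices in the charts of the
  atlas, as functions of the coordinates, subject to the transformation law
  \<open>T\<^sub>i\<^sub>j(y) = \<Sum>\<^sub>a\<^sub>b \<partial>\<^sub>i\<tau>\<^sup>a \<partial>\<^sub>j\<tau>\<^sup>b T'\<^sub>a\<^sub>b(\<tau> y)\<close> under the coordinate change \<open>\<tau>\<close>.  Values outside the
  range of a chart, or for charts outside the atlas, carry no meaning.\<close>

type_synonym 'n matrix_field = "real^'n \<Rightarrow> real^'n^'n"
type_synonym ('m, 'n) tensor2 = "('m, 'n) chart \<Rightarrow> 'n matrix_field"

definition smooth_tensor2 :: "('m, 'n::finite) chart set \<Rightarrow> ('m, 'n) tensor2 \<Rightarrow> bool" where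
  "smooth_tensor2 A T \<longleftrightarrow>
     (\<forall>c\<in>A. smooth_on (chart_range c) (T c)) \<and>
     (\<forall>c\<in>A. \<forall>d\<in>A. \<forall>y\<in>overlap c d.
        T c y = transpose (jacobian (transition c d) (at y)) ** T d (transition c d y)
                ** jacobian (transition c d) (at y))"

definition riemannian_metric :: "('m, 'n::finite) chart set \<Rightarrow> ('m, 'n) tensor2 \<Rightarrow> bool" where
  "riemannian_metric A g \<longleftrightarrow>
     smooth_tensor2 A g \<and>
     (\<forall>c\<in>A. \<forall>y\<in>chart_range c.
        transpose (g c y) = g c y \<and> (\<forall>v. v \<noteq> 0 \<longrightarrow> v \<bullet> (g c y *v v) > 0))"

definition tensor2_eq ::
    "('m, 'n::finite) chart set \<Rightarrow> ('m, 'n) tensor2 \<Rightarrow> ('m, 'n) tensor2 \<Rightarrow> bool" where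
  "tensor2_eq A S T \<longleftrightarrow> (\<forall>c\<in>A. \<forall>y\<in>chart_range c. S c y = T c y)"


section \<open>Curvature and Laplacian in local coordinates\<close>

text \<open>Here \<open>h\<close> is the component matrix of a metric in a chart.\<close>

definition inv_metric :: "'n::finite matrix_field \<Rightarrow> 'n matrix_field" where
  "inv_metric h y = matrix_inv (h y)"

text \<open>\<open>\<Gamma>\<^sup>k\<^sub>i\<^sub>j = 1/2 h\<^sup>k\<^sup>l (\<partial>\<^sub>i h\<^sub>j\<^sub>l + \<partial>\<^sub>j h\<^sub>i\<^sub>l - \<partial>\<^sub>l h\<^sub>i\<^sub>j)\<close>\<close>

definition christoffel :: "'n::finite matrix_field \<Rightarrow> 'n \<Rightarrow> 'n \<Rightarrow> 'n \<Rightarrow> real^'n \<Rightarrow> real" where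
  "christoffel h k i j y =
     1/2 * (\<Sum>l\<in>UNIV. inv_metric h y $ k $ l *
       (pderiv_at i (\<lambda>z. h z $ j $ l) y + pderiv_at j (\<lambda>z. h z $ i $ l) y
        - pderiv_at l (\<lambda>z. h z $ i $ j) y))"

text \<open>\<open>riemann h l k i j\<close> is the \<open>l\<close>-th component of
  \<open>R(\<partial>\<^sub>i,\<partial>\<^sub>j)\<partial>\<^sub>k = \<nabla>\<^sub>i \<nabla>\<^sub>j \<partial>\<^sub>k - \<nabla>\<^sub>j \<nabla>\<^sub>i \<partial>\<^sub>k\<close>, and \<open>Ric(Y,Z)\<close> is the trace of \<open>X \<mapsto> R(X,Y)Z\<close>;
  with these signs round spheres have positive Ricci curvature.\<close>

definition riemann ::
    "'n::finite matrix_field \<Rightarrow> 'n \<Rightarrow> 'n \<Rightarrow> 'n \<Rightarrow> 'n \<Rightarrow> real^'n \<Rightarrow> real" where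
  "riemann h l k i j y =
     pderiv_at i (christoffel h l j k) y - pderiv_at j (christoffel h l i k) y
     + (\<Sum>m\<in>UNIV. christoffel h l i m y * christoffel h m j k y
                  - christoffel h l j m y * christoffel h m i k y)"

definition ricci :: "'n::finite matrix_field \<Rightarrow> 'n matrix_field" where
  "ricci h y = (\<chi> j k. \<Sum>i\<in>UNIV. riemann h i k i j y)"

definition trace_wrt :: "'n::finite matrix_field \<Rightarrow> 'n matrix_field \<Rightarrow> real^'n \<Rightarrow> real" where
  "trace_wrt h T y = (\<Sum>i\<in>UNIV. \<Sum>j\<in>UNIV. inv_metric h y $ i $ j * T y $ i $ j)"

definition scalar_curvature :: "'n::finite matrix_field \<Rightarrow> real^'n \<Rightarrow> real" where
  "scalar_curvature h = trace_wrt h (ricci h)"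

definition traceless_ricci :: "'n::finite matrix_field \<Rightarrow> 'n matrix_field" where
  "traceless_ricci h y = ricci h y - (1 / real CARD('n) * scalar_curvature h y) *\<^sub>R h y"

definition tensor_norm :: "'n::finite matrix_field \<Rightarrow> 'n matrix_field \<Rightarrow> real^'n \<Rightarrow> real" where
  "tensor_norm h T y =
     sqrt (\<Sum>i\<in>UNIV. \<Sum>j\<in>UNIV. \<Sum>k\<in>UNIV. \<Sum>l\<in>UNIV.
       inv_metric h y $ i $ k * inv_metric h y $ j $ l * T y $ i $ j * T y $ k $ l)"

definition hessian :: "'n::finite matrix_field \<Rightarrow> (real^'n \<Rightarrow> real) \<Rightarrow> 'n matrix_field" where
  "hessian h f y = (\<chi> i j. pderiv_at j (pderiv_at i f) y
     - (\<Sum>k\<in>UNIV. christoffel h k i j y * pderiv_at k f y))"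

text \<open>The sign makes the Laplacian a positive operator.\<close>

definition laplacian :: "'n::finite matrix_field \<Rightarrow> (real^'n \<Rightarrow> real) \<Rightarrow> real^'n \<Rightarrow> real" where
  "laplacian h f y = - trace_wrt h (hessian h f) y"


section \<open>Metrics of scalar curvature -1\<close>

text \<open>The scalar quantities above do not depend on the chart; an identity between them on the
  manifold is expressed by requiring it in every chart of the atlas.\<close>

definition metrics_scal_minus_one :: "('m, 'n::finite) chart set \<Rightarrow> ('m, 'n) tensor2 set" where
  "metrics_scal_minus_one A =
     {g. riemannian_metric A g \<and>
         (\<forall>c\<in>A. \<forall>y\<in>chart_range c. scalar_curvature (g c) y = -1)}"

end

theory Submission
  imports Defs
begin

text \<open>
  Put \<open>\<kappa> = n - 1 > 0\<close>.  The right-hand side of the equation is nonnegative, so \<open>p\<close> satisfies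
  \<open>\<kappa> \<Delta>p + p \<ge> 0\<close>, and everything rests on the two maximum principles for such supersolutions.

  At a minimum of a function the Hessian is positive semidefinite, hence \<open>\<Delta> \<le> 0\<close> there
  (\<open>laplacian_local_min_le_0\<close>).  Evaluating the inequality at a minimum of \<open>p\<close>, which exists by
  compactness, gives \<open>p \<ge> 0\<close> (\<open>weak_maximum_principle\<close>).  A nonnegative supersolution that vanishes
  somewhere vanishes identically: its zero set is closed by continuity, and open by a barrier
  argument in a chart (\<open>strong_maximum_principle_ball\<close>).  So \<open>p\<close> is either
  identically zero or positive everywhere (\<open>strong_maximum_principle\<close>).

  It remains to see that \<open>p = 0\<close> exactly when \<open>Ric = - g / n\<close>.  As \<open>R = -1\<close>, the latter says that
  \<open>Ric\<^sup>T = 0\<close>.  If \<open>p = 0\<close>, then every point is a minimum of \<open>p\<close>, so the equation gives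
  \<open>|Ric\<^sup>T|\<^sup>2 \<le> 0\<close>, and \<open>Ric\<^sup>T = 0\<close> because the norm is definite (\<open>tensor_norm_eq_0_imp\<close>).  If
  \<open>Ric\<^sup>T = 0\<close>, then \<open>p\<close> and \<open>- p\<close> are both supersolutions, so both are nonnegative
  (\<open>homogeneous_solution_zero\<close>).

  The local arguments rest on linear algebra at a point: \<open>\<Delta>\<close> and \<open>|\<cdot>|\<close> are contractions with the inverse
  metric, and such a contraction of a positive semidefinite matrix is nonnegative
  (\<open>frobenius_nonneg\<close>).
\<close>

section \<open>Traces of products of positive matrices\<close>

definition pos_def :: "real^'n^'n::finite \<Rightarrow> bool" where
  "pos_def a \<longleftrightarrow> transpose a = a \<and> (\<forall>v. v \<noteq> 0 \<longrightarrow> v \<bullet> (a *v v) > 0)"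

definition frobenius :: "real^'n^'n::finite \<Rightarrow> real^'n^'n \<Rightarrow> real" where
  "frobenius a b = (\<Sum>i\<in>UNIV. \<Sum>j\<in>UNIV. a $ i $ j * b $ i $ j)"

lemma inner_matrix_vector_sum:
  fixes a :: "real^'n^'n::finite"
  shows "x \<bullet> (a *v y) = (\<Sum>i\<in>UNIV. \<Sum>j\<in>UNIV. a $ i $ j * x $ i * y $ j)"
  by (simp add: inner_vec_def matrix_vector_mult_def sum_distrib_left mult_ac)

lemma axis_inner_matrix_axis:
  fixes a :: "real^'n^'n::finite"
  shows "axis i 1 \<bullet> (a *v axis j 1) = a $ i $ j"
  by (simp add: inner_axis' matrix_vector_mul_component inner_axis)

lemma symmetric_inner:
  fixes a :: "real^'n^'n::finite"
  assumes "transpose a = a"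
  shows "x \<bullet> (a *v y) = y \<bullet> (a *v x)"
  by (metis assms dot_lmul_matrix inner_commute transpose_matrix_vector)

lemma quadratic_form_shift:
  fixes a :: "real^'n^'n::finite"
  assumes "transpose a = a"
  shows "(x + t *\<^sub>R e) \<bullet> (a *v (x + t *\<^sub>R e)) =
    x \<bullet> (a *v x) + 2 * t * (e \<bullet> (a *v x)) + t\<^sup>2 * (e \<bullet> (a *v e))"
  using symmetric_inner[OF assms, of x e]
  by (simp add: matrix_vector_right_distrib matrix_vector_mult_scaleR inner_add_left
      inner_add_right power2_eq_square algebra_simps)

lemma symmetric_component:
  fixes a :: "real^'n^'n::finite"
  assumes "transpose a = a"
  shows "a $ i $ j = a $ j $ i"
proof -
  have "transpose a $ i $ j = a $ j $ i" by (simp add: transpose_def)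
  then show ?thesis by (simp add: assms)
qed

text \<open>Otherwise the quadratic form at \<open>e\<^sub>j + t e\<^sub>k\<close> would be a nonconstant affine function of \<open>t\<close>, and so
take negative values.\<close>

lemma psd_diag_zero_row:
  fixes a :: "real^'n^'n::finite"
  assumes sym: "transpose a = a" and psd: "\<And>x. x \<bullet> (a *v x) \<ge> 0" and z: "a $ k $ k = 0"
  shows "a $ k $ j = 0"
proof (rule ccontr)
  assume nz: "a $ k $ j \<noteq> 0"
  \<comment> \<open>the value of \<open>t\<close> at which the form equals \<open>-1\<close>\<close>
  let ?t = "- (a $ j $ j + 1) / (2 * a $ k $ j)"
  have "0 \<le> a $ j $ j + 2 * ?t * a $ k $ j"
    using psd[of "axis j 1 + ?t *\<^sub>R axis k 1"]
    unfolding quadratic_form_shift[OF sym] axis_inner_matrix_axis z by simp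
  moreover have "2 * ?t * a $ k $ j = - (a $ j $ j + 1)" using nz by simp
  ultimately show False by linarith
qed

text \<open>Symmetric elimination writes \<open>a\<close> as a sum of matrices \<open>s s\<^sup>T\<close>, and the contraction of \<open>s s\<^sup>T\<close> with \<open>H\<close>
is \<open>s\<^sup>T H s \<ge> 0\<close>.  The induction is on a set of indices \<open>S\<close> outside which \<open>a\<close> vanishes; one
elimination step replaces \<open>a\<close> by its Schur complement with respect to the entry at \<open>k\<close>.\<close>

lemma frobenius_nonneg:
  fixes a H :: "real^'n^'n::finite"
  assumes sym: "transpose a = a" and psd: "\<And>x. x \<bullet> (a *v x) \<ge> 0"
    and H: "\<And>x. x \<bullet> (H *v x) \<ge> 0"
  shows "frobenius a H \<ge> 0"
proof -
  have "frobenius a H \<ge> 0"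
    if "finite S" "transpose a = a" "\<And>x. x \<bullet> (a *v x) \<ge> 0"
      "\<And>i j. i \<notin> S \<Longrightarrow> a $ i $ j = 0" for a and S :: "'n set"
    using that
  proof (induction S arbitrary: a rule: finite_induct)
    case empty
    then show ?case by (simp add: frobenius_def)
  next
    case (insert k S a)
    note sym = insert.prems(1) and psd = insert.prems(2)
    note symc = symmetric_component[OF sym]
    show ?case
    proof (cases "a $ k $ k = 0")
      case True
      have "a $ i $ j = 0" if "i \<notin> S" for i j
        using insert.prems(3)[of i j] psd_diag_zero_row[OF sym psd True, of j] that by auto
      then show ?thesis using insert.IH[OF sym psd] by blast
    next
      case False
      then have pos: "a $ k $ k > 0"
        using psd[of "axis k 1"] by (simp add: axis_inner_matrix_axis)
      \<comment> \<open>the Schur complement, whose \<open>k\<close>-th row and column vanish\<close>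
      define b where "b = (\<chi> i j. a $ i $ j - a $ i $ k * a $ j $ k / a $ k $ k)"
      have col: "axis k 1 \<bullet> (a *v x) = (\<Sum>i\<in>UNIV. a $ i $ k * x $ i)" for x
        by (simp add: inner_axis' matrix_vector_mult_def symc[of k])
      have "transpose b = b"
        by (simp add: b_def transpose_def vec_eq_iff symc mult.commute)
      moreover have "x \<bullet> (b *v x) \<ge> 0" for x
      proof -
        let ?s = "axis k 1 \<bullet> (a *v x)"
        have "?s * ?s = (\<Sum>i\<in>UNIV. \<Sum>j\<in>UNIV. (a $ i $ k * x $ i) * (a $ j $ k * x $ j))"
          by (simp only: col sum_product)
        then have "x \<bullet> (b *v x) = x \<bullet> (a *v x) - ?s * ?s / a $ k $ k"
          by (simp add: inner_matrix_vector_sum[of x] b_def sum_subtractf[symmetric]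
              sum_divide_distrib algebra_simps)
        \<comment> \<open>completing the square: the form of \<open>b\<close> at \<open>x\<close> is that of \<open>a\<close> at the \<open>a\<close>-orthogonal projection of \<open>x\<close>\<close>
        also have "\<dots> = (x + (- ?s / a $ k $ k) *\<^sub>R axis k 1) \<bullet>
            (a *v (x + (- ?s / a $ k $ k) *\<^sub>R axis k 1))"
          unfolding quadratic_form_shift[OF sym] axis_inner_matrix_axis
          using pos by (simp add: field_simps power2_eq_square)
        finally show ?thesis using psd by simp
      qed
      moreover have "b $ i $ j = 0" if "i \<notin> S" for i j
        using insert.prems(3)[of i] that pos by (cases "i = k") (auto simp: b_def symc[of k j])
      ultimately have "frobenius b H \<ge> 0" by (rule insert.IH)
      moreover have "frobenius a H = frobenius b H
          + (\<chi> i. a $ i $ k) \<bullet> (H *v (\<chi> i. a $ i $ k)) / a $ k $ k"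
        unfolding frobenius_def inner_matrix_vector_sum b_def sum_divide_distrib
        by (simp add: sum.distrib[symmetric] algebra_simps)
      ultimately show ?thesis using pos H by simp
    qed
  qed
  from this[of UNIV a] show ?thesis using sym psd by simp
qed

lemma pos_def_ge_identity:
  fixes a :: "real^'n^'n::finite"
  assumes "pos_def a"
  obtains l where "l > 0" "\<And>x. x \<bullet> (a *v x) \<ge> l * (x \<bullet> x)"
proof -
  have "sphere (0::real^'n) 1 \<noteq> {}" by simp
  moreover have "continuous_on (sphere 0 1) (\<lambda>x::real^'n. x \<bullet> (a *v x))"
    by (intro continuous_intros)
  ultimately have "\<exists>u\<in>sphere 0 1. \<forall>x\<in>sphere 0 1. u \<bullet> (a *v u) \<le> x \<bullet> (a *v x)"
    by (intro continuous_attains_inf compact_sphere)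
  then obtain u where u: "u \<in> sphere 0 1"
    "\<And>x. x \<in> sphere 0 1 \<Longrightarrow> u \<bullet> (a *v u) \<le> x \<bullet> (a *v x)" by blast
  show thesis
  proof
    have "u \<noteq> 0" using u(1) by auto
    then show "u \<bullet> (a *v u) > 0" using assms by (simp add: pos_def_def)
    show "x \<bullet> (a *v x) \<ge> u \<bullet> (a *v u) * (x \<bullet> x)" for x
    proof (cases "x = 0")
      case False
      let ?y = "(1 / norm x) *\<^sub>R x"
      have "x \<bullet> (a *v x) = norm x ^ 2 * (?y \<bullet> (a *v ?y))"
        using False by (simp add: matrix_vector_mult_scaleR field_simps power2_eq_square)
      moreover have "u \<bullet> (a *v u) \<le> ?y \<bullet> (a *v ?y)" using False by (intro u(2)) simp
      ultimately show ?thesis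
        by (metis dot_square_norm mult.commute mult_left_mono zero_le_power2)
    qed simp
  qed
qed

text \<open>For small \<open>l > 0\<close> the matrix \<open>a - l 1\<close> is still positive semidefinite, so the contraction of \<open>a\<close> with
\<open>H\<close> is at least \<open>l\<close> times the trace of \<open>H\<close>, a sum of nonnegative terms.\<close>

lemma frobenius_zero_imp:
  fixes a H :: "real^'n^'n::finite"
  assumes a: "pos_def a" and H: "\<And>x. x \<bullet> (H *v x) \<ge> 0" and z: "frobenius a H = 0"
  shows "H $ i $ i = 0"
proof -
  obtain l where l: "l > 0" "\<And>x. x \<bullet> (a *v x) \<ge> l * (x \<bullet> x)"
    using pos_def_ge_identity[OF a] by blast
  define b where "b = a - l *\<^sub>R mat 1"
  have diag: "H $ i $ i \<ge> 0" for i using H[of "axis i 1"] by (simp add: axis_inner_matrix_axis)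
  have "transpose b = b"
    using a by (simp add: b_def pos_def_def transpose_def mat_def vec_eq_iff)
  moreover have "x \<bullet> (b *v x) \<ge> 0" for x
    using l(2)[of x]
    by (simp add: b_def matrix_vector_mult_diff_rdistrib inner_diff_right
        scaleR_matrix_vector_assoc[symmetric])
  ultimately have "frobenius b H \<ge> 0" using H by (intro frobenius_nonneg)
  moreover have "frobenius b H = frobenius a H - l * (\<Sum>i\<in>UNIV. H $ i $ i)"
  proof -
    have comp: "b $ i $ j = a $ i $ j - (if i = j then l else 0)" for i j
      by (simp add: b_def mat_def)
    have "b $ i $ j * H $ i $ j = a $ i $ j * H $ i $ j - (if i = j then l * H $ i $ j else 0)" for i j
      unfolding comp by (simp add: left_diff_distrib)
    then show ?thesis
      by (simp add: frobenius_def sum_subtractf sum_distrib_left)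
  qed
  ultimately have "(\<Sum>i\<in>UNIV. H $ i $ i) \<le> 0" using l(1) z
    by (simp add: mult_le_0_iff)
  moreover have "(\<Sum>i\<in>UNIV. H $ i $ i) \<ge> 0" by (rule sum_nonneg) (rule diag)
  ultimately have "(\<Sum>i\<in>UNIV. H $ i $ i) = 0" by linarith
  then have "\<forall>i\<in>UNIV. H $ i $ i = 0"
    using diag by (subst (asm) sum_nonneg_eq_0_iff) auto
  then show ?thesis by blast
qed

lemma pos_def_det_nz:
  fixes h :: "real^'n^'n::finite"
  assumes "pos_def h"
  shows "det h \<noteq> 0"
proof -
  have "h *v x = 0 \<Longrightarrow> x = 0" for x
    using assms unfolding pos_def_def by (metis inner_zero_right less_irrefl)
  then have "\<exists>B. B ** h = mat 1" using matrix_left_invertible_ker by blast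
  then show ?thesis using invertible_det_nz invertible_left_inverse by blast
qed

lemma matrix_inv_inverse:
  fixes h :: "real^'n^'n::finite"
  assumes "pos_def h"
  shows "h ** matrix_inv h = mat 1" "matrix_inv h ** h = mat 1"
proof -
  have "invertible h" using pos_def_det_nz[OF assms] invertible_det_nz by blast
  then show "h ** matrix_inv h = mat 1" "matrix_inv h ** h = mat 1"
    unfolding invertible_def matrix_inv_def by (metis (mono_tags, lifting) someI_ex)+
qed

lemma pos_def_matrix_inv:
  fixes h :: "real^'n^'n::finite"
  assumes "pos_def h"
  shows "pos_def (matrix_inv h)"
proof -
  note I = matrix_inv_inverse[OF assms]
  have sym: "transpose h = h" using assms by (simp add: pos_def_def)
  have "transpose (matrix_inv h) ** h = mat 1"
    by (metis I(1) matrix_transpose_mul sym transpose_mat)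
  then have "transpose (matrix_inv h) = matrix_inv h"
    by (metis I(1) matrix_mul_assoc matrix_mul_lid matrix_mul_rid)
  moreover have "v \<bullet> (matrix_inv h *v v) > 0" if "v \<noteq> 0" for v
  proof -
    let ?w = "matrix_inv h *v v"
    have hw: "h *v ?w = v" by (simp add: matrix_vector_mul_assoc I)
    then have "?w \<noteq> 0" using that by (metis matrix_vector_mult_0_right)
    then show ?thesis using assms hw unfolding pos_def_def by (metis inner_commute)
  qed
  ultimately show ?thesis by (simp add: pos_def_def)
qed

lemma continuous_on_det:
  fixes F :: "'a::topological_space \<Rightarrow> real^'n^'n::finite"
  assumes "\<And>i j. continuous_on S (\<lambda>y. F y $ i $ j)"
  shows "continuous_on S (\<lambda>y. det (F y))"
  unfolding det_def by (intro continuous_intros assms)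

text \<open>Cramer's rule expresses the entries of the inverse as quotients of determinants.\<close>

lemma continuous_on_matrix_inv:
  fixes F :: "'a::topological_space \<Rightarrow> real^'n^'n::finite"
  assumes c: "\<And>i j. continuous_on S (\<lambda>y. F y $ i $ j)" and p: "\<And>y. y \<in> S \<Longrightarrow> pos_def (F y)"
  shows "continuous_on S (\<lambda>y. matrix_inv (F y) $ k $ l)"
proof -
  let ?G = "\<lambda>y. (\<chi> i j. if j = k then axis l 1 $ i else F y $ i $ j) :: real^'n^'n"
  have "matrix_inv (F y) $ k $ l = det (?G y) / det (F y)" if "y \<in> S" for y
  proof -
    have "F y *v (matrix_inv (F y) *v axis l 1) = axis l 1"
      by (simp add: matrix_vector_mul_assoc matrix_inv_inverse[OF p[OF that]])
    then have "matrix_inv (F y) *v axis l 1 =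
        (\<chi> k. det (\<chi> i j. if j = k then axis l 1 $ i else F y $ i $ j) / det (F y))"
      using cramer[OF pos_def_det_nz[OF p[OF that]]] by blast
    then show ?thesis
      by (metis (mono_tags, lifting) axis_inner_matrix_axis inner_axis' inner_real_def
          mult_1 vec_lambda_beta)
  qed
  moreover have "continuous_on S (\<lambda>y. ?G y $ i $ j)" for i j
    by (cases "j = k") (simp_all add: c)
  then have "continuous_on S (\<lambda>y. det (?G y) / det (F y))"
    by (intro continuous_on_divide continuous_on_det c) (use pos_def_det_nz p in auto)
  ultimately show ?thesis by (simp cong: continuous_on_cong)
qed

section \<open>The second derivative test\<close>

definition twice_differentiable_on :: "(real^'n::finite \<Rightarrow> real) \<Rightarrow> (real^'n) set \<Rightarrow> bool" where
  "twice_differentiable_on f S \<longleftrightarrow>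
     (\<forall>y\<in>S. f differentiable at y \<and> (\<forall>i. pderiv_at i f differentiable at y))"

lemma pderiv_at_eqI:
  assumes "(f has_derivative f') (at y)"
  shows "pderiv_at i f y = f' (axis i 1)"
  using frechet_derivative_at[OF assms] by (simp add: pderiv_at_def)

lemma has_derivative_pderiv:
  assumes "f differentiable at y"
  shows "(f has_derivative (\<lambda>v. \<Sum>i\<in>UNIV. v $ i * pderiv_at i f y)) (at y)"
proof -
  let ?D = "frechet_derivative f (at y)"
  have D: "(f has_derivative ?D) (at y)" using assms frechet_derivative_works by blast
  then have lin: "linear ?D" by (rule has_derivative_linear)
  have "?D v = (\<Sum>i\<in>UNIV. v $ i * pderiv_at i f y)" for v
  proof -
    have "?D v = ?D (\<Sum>i\<in>UNIV. v $ i *\<^sub>R axis i 1)"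
      by (subst basis_expansion[of v, symmetric]) (simp add: scalar_mult_eq_scaleR)
    also have "\<dots> = (\<Sum>i\<in>UNIV. v $ i * pderiv_at i f y)"
      by (simp add: linear_sum[OF lin] linear_cmul[OF lin] pderiv_at_def)
    finally show ?thesis .
  qed
  then show ?thesis using D by (metis (no_types, lifting) ext)
qed

lemma pderiv_at_cong:
  assumes "open S" "y \<in> S" "\<And>z. z \<in> S \<Longrightarrow> f z = g z" "f differentiable at y"
  shows "pderiv_at i f y = pderiv_at i g y"
  using frechet_derivative_transform_within_open[OF assms(4,1,2,3)] by (simp add: pderiv_at_def)

lemma differentiable_lincomb:
  fixes f g :: "'a::real_normed_vector \<Rightarrow> real"
  shows "f differentiable at y \<Longrightarrow> g differentiable at y \<Longrightarrow>
    (\<lambda>z. a * f z + b * g z) differentiable at y"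
  by (intro derivative_intros)

lemma pderiv_at_lincomb:
  assumes "f differentiable at y" "g differentiable at y"
  shows "pderiv_at i (\<lambda>z. a * f z + b * g z) y = a * pderiv_at i f y + b * pderiv_at i g y"
proof -
  let ?f = "frechet_derivative f (at y)" and ?g = "frechet_derivative g (at y)"
  have "((\<lambda>z. a * f z + b * g z) has_derivative (\<lambda>v. a * ?f v + b * ?g v)) (at y)"
    using assms frechet_derivative_works by (intro derivative_intros) blast+
  then show ?thesis by (simp add: pderiv_at_eqI pderiv_at_def[of i f] pderiv_at_def[of i g])
qed

lemma
  fixes f g :: "real^'n::finite \<Rightarrow> real"
  assumes S: "open S" and f: "twice_differentiable_on f S" and g: "twice_differentiable_on g S"
  shows twice_differentiable_on_lincomb:
      "twice_differentiable_on (\<lambda>z. a * f z + b * g z) S"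
    and pderiv2_lincomb: "y \<in> S \<Longrightarrow> pderiv_at j (pderiv_at i (\<lambda>z. a * f z + b * g z)) y =
      a * pderiv_at j (pderiv_at i f) y + b * pderiv_at j (pderiv_at i g) y"
proof -
  let ?w = "\<lambda>z. a * f z + b * g z"
  have eq: "a * pderiv_at i f z + b * pderiv_at i g z = pderiv_at i ?w z" if "z \<in> S" for i z
    using f g that by (simp add: pderiv_at_lincomb twice_differentiable_on_def)
  have d: "(\<lambda>z. a * pderiv_at i f z + b * pderiv_at i g z) differentiable at z"
    if "z \<in> S" for i z
    using f g that by (simp add: differentiable_lincomb twice_differentiable_on_def)
  have "pderiv_at i ?w differentiable at z" if "z \<in> S" for i z
    using d[OF that, of i] eq S that unfolding differentiable_def
    by (meson has_derivative_transform_within_open)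
  then show "twice_differentiable_on ?w S"
    using f g by (simp add: differentiable_lincomb twice_differentiable_on_def)
  show "pderiv_at j (pderiv_at i ?w) y =
      a * pderiv_at j (pderiv_at i f) y + b * pderiv_at j (pderiv_at i g) y" if "y \<in> S"
    using pderiv_at_cong[OF S that eq d[OF that], of j i] f g that
    by (simp add: pderiv_at_lincomb twice_differentiable_on_def)
qed

text \<open>If \<open>l < 0\<close>, then \<open>\<psi>\<close> is negative to the right of \<open>0\<close>, and \<open>\<phi>\<close> decreases there.\<close>

lemma real_second_derivative_test:
  fixes \<phi> \<psi> :: "real \<Rightarrow> real"
  assumes d: "d > 0" and \<phi>: "\<And>t. \<bar>t\<bar> < d \<Longrightarrow> (\<phi> has_real_derivative \<psi> t) (at t)"
    and \<psi>: "(\<psi> has_real_derivative l) (at 0)" and z: "\<psi> 0 = 0"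
    and min: "\<And>t. \<bar>t\<bar> < d \<Longrightarrow> \<phi> 0 \<le> \<phi> t"
  shows "l \<ge> 0"
proof (rule ccontr)
  assume "\<not> l \<ge> 0"
  then obtain e where e: "e > 0" "\<And>t. 0 < t \<Longrightarrow> t < e \<Longrightarrow> \<psi> t < 0"
    using has_real_derivative_neg_dec_right[OF \<psi>] z by auto
  define s where "s = min d e / 2"
  have s: "0 < s" "s < d" "s < e" using d e(1) by (auto simp: s_def)
  have "\<phi> 0 > \<phi> s"
  proof (rule DERIV_neg_imp_decreasing_open[OF s(1)])
    show "\<exists>y. (\<phi> has_real_derivative y) (at x) \<and> y < 0" if "0 < x" "x < s" for x
      using \<phi>[of x] e(2)[of x] that s by auto
    show "continuous_on {0..s} \<phi>"
      by (rule DERIV_continuous_on[of _ _ \<psi>]) (use \<phi> s in \<open>auto intro: has_field_derivative_at_within\<close>)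
  qed
  then show False using min[of s] s by auto
qed

lemma
  fixes f :: "real^'n::finite \<Rightarrow> real"
  assumes S: "open S" "y \<in> S" and f: "twice_differentiable_on f S"
    and min: "\<And>z. z \<in> S \<Longrightarrow> f y \<le> f z"
  shows pderiv_at_local_min: "pderiv_at i f y = 0"
    and pderiv2_local_min: "x \<bullet> ((\<chi> i j. pderiv_at j (pderiv_at i f) y) *v x) \<ge> 0"
proof -
  have fd: "f differentiable at z" and pd: "pderiv_at i f differentiable at z"
    if "z \<in> S" for z i
    using f that by (auto simp: twice_differentiable_on_def)
  have "frechet_derivative f (at y) = (\<lambda>v. 0)"
    using differential_zero_maxmin[OF S(2,1) iffD1[OF frechet_derivative_works fd[OF S(2)]]] min
    by blast
  then show grad: "pderiv_at i f y = 0" for i by (simp add: pderiv_at_def)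
  obtain e where e: "e > 0" "ball y e \<subseteq> S" using S open_contains_ball by blast
  define d where "d = e / (norm x + 1)"
  have d: "d > 0" using e by (simp add: d_def add_nonneg_pos)
  have inS: "y + t *\<^sub>R x \<in> S" if "\<bar>t\<bar> < d" for t
  proof -
    have "\<bar>t\<bar> * norm x \<le> \<bar>t\<bar> * (norm x + 1)" by (simp add: mult_left_mono)
    also have "\<dots> < e" using that by (simp add: d_def less_divide_eq add_nonneg_pos)
    finally show ?thesis using e(2) by (auto simp: subset_eq dist_norm)
  qed
  define \<phi> where "\<phi> t = f (y + t *\<^sub>R x)" for t
  define \<psi> where "\<psi> t = (\<Sum>i\<in>UNIV. x $ i * pderiv_at i f (y + t *\<^sub>R x))" for t
  have along: "((\<lambda>t. k (y + t *\<^sub>R x)) has_real_derivative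
      (\<Sum>i\<in>UNIV. x $ i * pderiv_at i k (y + t *\<^sub>R x))) (at t)"
    if k: "k differentiable at (y + t *\<^sub>R x)" for k t
  proof -
    have "((\<lambda>t. y + t *\<^sub>R x) has_derivative (\<lambda>s. s *\<^sub>R x)) (at t)"
      by (auto intro!: derivative_eq_intros)
    from has_derivative_compose[OF this has_derivative_pderiv[OF k]]
    show ?thesis
      unfolding has_field_derivative_def
      by (rule has_derivative_eq_rhs) (simp add: fun_eq_iff sum_distrib_left mult_ac)
  qed
  have 1: "(\<phi> has_real_derivative \<psi> t) (at t)" if "\<bar>t\<bar> < d" for t
    unfolding \<phi>_def \<psi>_def by (rule along[OF fd[OF inS[OF that]]])
  have "((\<lambda>t. pderiv_at i f (y + t *\<^sub>R x)) has_real_derivative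
      (\<Sum>j\<in>UNIV. x $ j * pderiv_at j (pderiv_at i f) y)) (at 0)" for i
    using along[of "pderiv_at i f" 0] pd S(2) by simp
  then have 2: "(\<psi> has_real_derivative
      (\<Sum>i\<in>UNIV. x $ i * (\<Sum>j\<in>UNIV. x $ j * pderiv_at j (pderiv_at i f) y))) (at 0)"
    unfolding \<psi>_def by (intro derivative_eq_intros) auto
  have 3: "\<psi> 0 = 0" by (simp add: \<psi>_def grad)
  have 4: "\<phi> 0 \<le> \<phi> t" if "\<bar>t\<bar> < d" for t using min[OF inS[OF that]] by (simp add: \<phi>_def)
  have "(\<Sum>i\<in>UNIV. x $ i * (\<Sum>j\<in>UNIV. x $ j * pderiv_at j (pderiv_at i f) y)) \<ge> 0"
    by (rule real_second_derivative_test[OF d 1 2 3 4])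
  then show "x \<bullet> ((\<chi> i j. pderiv_at j (pderiv_at i f) y) *v x) \<ge> 0"
    by (simp add: inner_matrix_vector_sum sum_distrib_left mult_ac)
qed

section \<open>The Laplacian in a chart\<close>

text \<open>The coefficients \<open>h\<^sup>i\<^sup>j \<Gamma>\<^sup>k\<^sub>i\<^sub>j\<close> of the first-order part of the Laplacian.\<close>

definition drift :: "'n::finite matrix_field \<Rightarrow> 'n \<Rightarrow> real^'n \<Rightarrow> real" where
  "drift h k y = (\<Sum>i\<in>UNIV. \<Sum>j\<in>UNIV. inv_metric h y $ i $ j * christoffel h k i j y)"

lemma laplacian_expand:
  "laplacian h f y = (\<Sum>k\<in>UNIV. drift h k y * pderiv_at k f y)
     - frobenius (inv_metric h y) (\<chi> i j. pderiv_at j (pderiv_at i f) y)"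
proof -
  let ?a = "\<lambda>i j. inv_metric h y $ i $ j"
  have "(\<Sum>i\<in>UNIV. \<Sum>j\<in>UNIV. \<Sum>k\<in>UNIV. ?a i j * (christoffel h k i j y * pderiv_at k f y))
      = (\<Sum>k\<in>UNIV. \<Sum>i\<in>UNIV. \<Sum>j\<in>UNIV. ?a i j * (christoffel h k i j y * pderiv_at k f y))"
    (is "(\<Sum>i\<in>UNIV. \<Sum>j\<in>UNIV. \<Sum>k\<in>UNIV. ?F i j k) = _")
  proof -
    have "(\<Sum>i\<in>UNIV. \<Sum>j\<in>UNIV. \<Sum>k\<in>UNIV. ?F i j k)
        = (\<Sum>i\<in>UNIV. \<Sum>k\<in>UNIV. \<Sum>j\<in>UNIV. ?F i j k)"
      by (rule sum.cong[OF refl]) (rule sum.swap)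
    also have "\<dots> = (\<Sum>k\<in>UNIV. \<Sum>i\<in>UNIV. \<Sum>j\<in>UNIV. ?F i j k)"
      by (rule sum.swap)
    finally show ?thesis .
  qed
  then show ?thesis
    by (simp add: laplacian_def trace_wrt_def hessian_def frobenius_def drift_def
        right_diff_distrib sum_subtractf sum_distrib_left sum_distrib_right mult_ac)
qed

lemma laplacian_lincomb:
  assumes "open S" "twice_differentiable_on f S" "twice_differentiable_on g S" "y \<in> S"
  shows "laplacian h (\<lambda>z. a * f z + b * g z) y = a * laplacian h f y + b * laplacian h g y"
proof -
  have "pderiv_at k (\<lambda>z. a * f z + b * g z) y = a * pderiv_at k f y + b * pderiv_at k g y" for k
    using assms by (simp add: pderiv_at_lincomb twice_differentiable_on_def)
  then show ?thesis
    by (simp add: laplacian_expand frobenius_def pderiv2_lincomb[OF assms(1-4)]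
        algebra_simps sum.distrib sum_distrib_left)
qed

lemma laplacian_local_min_le_0:
  assumes S: "open S" "y \<in> S" and f: "twice_differentiable_on f S"
    and min: "\<And>z. z \<in> S \<Longrightarrow> f y \<le> f z" and h: "pos_def (h y)"
  shows "laplacian h f y \<le> 0"
proof -
  have a: "pos_def (inv_metric h y)" using pos_def_matrix_inv[OF h] by (simp add: inv_metric_def)
  have "x \<bullet> (inv_metric h y *v x) \<ge> 0" for x
    using a unfolding pos_def_def by (cases "x = 0") (auto intro: less_imp_le)
  then have "frobenius (inv_metric h y) (\<chi> i j. pderiv_at j (pderiv_at i f) y) \<ge> 0"
    using a pderiv2_local_min[OF S f min] by (intro frobenius_nonneg) (auto simp: pos_def_def)
  then show ?thesis by (simp add: laplacian_expand pderiv_at_local_min[OF S f min])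
qed

text \<open>For large \<open>\<alpha>\<close> the term quadratic in \<open>\<alpha>\<close> dominates away from the centre \<open>x\<close>, because the inverse
metric is positive definite; if \<open>s \<ge> 0\<close>, the function is there a strict subsolution of
\<open>\<kappa> \<Delta> + 1\<close> for each fixed \<open>\<kappa> > 0\<close>.\<close>

lemma barrier_derivs:
  fixes x y :: "real^'n::finite" and \<alpha> s :: real
  defines "b \<equiv> \<lambda>z. exp (- \<alpha> * ((z - x) \<bullet> (z - x))) - s"
  shows "twice_differentiable_on b S"
    and "laplacian h b y = - exp (- \<alpha> * ((y - x) \<bullet> (y - x))) *
      (4 * \<alpha>\<^sup>2 * ((y - x) \<bullet> (inv_metric h y *v (y - x)))
       - 2 * \<alpha> * ((\<Sum>i\<in>UNIV. inv_metric h y $ i $ i) - (\<Sum>k\<in>UNIV. drift h k y * (y - x) $ k)))"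
proof -
  let ?E = "\<lambda>z. exp (- \<alpha> * ((z - x) \<bullet> (z - x)))"
  have D1: "(b has_derivative (\<lambda>v. - 2 * \<alpha> * ((z - x) \<bullet> v) * ?E z)) (at z)" for z
    unfolding b_def
    by (auto intro!: derivative_eq_intros simp: inner_commute algebra_simps)
  then have p1: "pderiv_at i b = (\<lambda>z. - 2 * \<alpha> * (z - x) $ i * ?E z)" for i
    by (simp add: fun_eq_iff pderiv_at_eqI[OF D1] inner_axis)
  have D2: "(pderiv_at i b has_derivative
      (\<lambda>v. - 2 * \<alpha> * v $ i * ?E z + 4 * \<alpha>\<^sup>2 * (z - x) $ i * ((z - x) \<bullet> v) * ?E z)) (at z)" for i z
    unfolding p1
    by (auto intro!: derivative_eq_intros bounded_linear.has_derivative[OF bounded_linear_vec_nth]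
        simp: inner_commute algebra_simps power2_eq_square)
  show "twice_differentiable_on b S"
    using D1 D2 unfolding twice_differentiable_on_def differentiable_def by blast
  have p2: "pderiv_at j (pderiv_at i b) y = - 2 * \<alpha> * (if i = j then 1 else 0) * ?E y
      + 4 * \<alpha>\<^sup>2 * (y - x) $ i * (y - x) $ j * ?E y" for i j
    by (simp add: pderiv_at_eqI[OF D2] inner_axis) (simp add: axis_def)
  have "frobenius (inv_metric h y) (\<chi> i j. pderiv_at j (pderiv_at i b) y) =
      ?E y * (4 * \<alpha>\<^sup>2 * ((y - x) \<bullet> (inv_metric h y *v (y - x)))
        - 2 * \<alpha> * (\<Sum>i\<in>UNIV. inv_metric h y $ i $ i))"
  proof -
    have "(\<Sum>i\<in>UNIV. inv_metric h y $ i $ i) =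
        (\<Sum>i\<in>UNIV. \<Sum>j\<in>UNIV. inv_metric h y $ i $ j * (if i = j then 1 else 0))"
      by (simp add: if_distrib cong: if_cong)
    then show ?thesis
      unfolding frobenius_def p2 inner_matrix_vector_sum
      by (simp add: sum_distrib_left sum_subtractf[symmetric] algebra_simps del: mult_if_delta
        cong: if_cong)
  qed
  moreover have "(\<Sum>k\<in>UNIV. drift h k y * pderiv_at k b y) =
      ?E y * (- 2 * \<alpha> * (\<Sum>k\<in>UNIV. drift h k y * (y - x) $ k))"
    unfolding p1 sum_distrib_left by (rule sum.cong) (simp_all add: mult_ac)
  ultimately show "laplacian h b y = - ?E y *
      (4 * \<alpha>\<^sup>2 * ((y - x) \<bullet> (inv_metric h y *v (y - x)))
       - 2 * \<alpha> * ((\<Sum>i\<in>UNIV. inv_metric h y $ i $ i) - (\<Sum>k\<in>UNIV. drift h k y * (y - x) $ k)))"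
    unfolding laplacian_expand by (simp only:) (simp add: algebra_simps)
qed

text \<open>Suppose \<open>u y = 0\<close> and put \<open>\<rho> = |y - x|\<close>.  Let \<open>v\<close> be the barrier \<open>exp (- \<alpha> |z - x|\<^sup>2)\<close>, shifted by a
constant so that it vanishes on the sphere of radius \<open>\<rho>\<close>.  On the closed shell \<open>K\<close> between a sphere of
small radius \<open>r\<close>, where \<open>u \<ge> \<epsilon> > 0\<close>, and the sphere of radius \<open>R > \<rho>\<close>, consider \<open>w = u - \<epsilon> v\<close>.  It is
positive on the inner sphere because \<open>v < 1\<close>, and on the outer sphere because \<open>v < 0 \<le> u\<close>.  But
\<open>w y = 0\<close>, so its minimum over \<open>K\<close> is nonpositive and lies in the interior, where \<open>\<kappa> \<Delta>w \<le> 0\<close>.  This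
contradicts \<open>\<kappa> \<Delta>w + w > 0\<close>, which holds on all of \<open>K\<close> once \<open>\<alpha>\<close> is large.  The shell extends beyond
the radius \<open>\<rho>\<close> so that \<open>y\<close>, and with it the minimum, lies away from the boundary.\<close>

lemma strong_maximum_principle_ball:
  fixes u :: "real^'n::finite \<Rightarrow> real"
  assumes S: "open S" and h: "\<And>y. y \<in> S \<Longrightarrow> pos_def (h y)"
    and ca: "\<And>i j. continuous_on S (\<lambda>y. inv_metric h y $ i $ j)"
    and cb: "\<And>k. continuous_on S (drift h k)"
    and u: "twice_differentiable_on u S" and nonneg: "\<And>y. y \<in> S \<Longrightarrow> u y \<ge> 0"
    and \<kappa>: "\<kappa> > 0" and super: "\<And>y. y \<in> S \<Longrightarrow> \<kappa> * laplacian h u y + u y \<ge> 0"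
    and sub: "cball x R \<subseteq> S" and x: "u x > 0" and y: "y \<in> ball x R"
  shows "u y > 0"
proof (rule ccontr)
  assume "\<not> u y > 0"
  then have uy: "u y = 0" using nonneg[of y] sub y by force
  have cu: "continuous_on S u"
    using u unfolding twice_differentiable_on_def
    by (meson continuous_at_imp_continuous_on differentiable_imp_continuous_within)
  define \<rho> where "\<rho> = dist x y"
  have \<rho>: "0 < \<rho>" "\<rho> < R" using x uy y by (auto simp: \<rho>_def)
  have xS: "x \<in> S" using sub \<rho> by auto
  obtain r1 where r1: "r1 > 0" "\<And>z. z \<in> S \<Longrightarrow> dist z x < r1 \<Longrightarrow> dist (u z) (u x) < u x"
    using cu xS x unfolding continuous_on_iff by metis
  define r where "r = min r1 \<rho> / 2"
  have r: "0 < r" "r < r1" "r < \<rho>" using r1(1) \<rho> by (auto simp: r_def)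
  define K where "K = cball x R - ball x r"
  have K: "compact K" by (simp add: K_def compact_diff)
  have KS: "K \<subseteq> S" using sub by (auto simp: K_def)
  have yK: "y \<in> K" using r \<rho> by (auto simp: K_def \<rho>_def dist_commute)
  then have Kne: "K \<noteq> {}" by blast
  have "sphere x r \<subseteq> S" using sub r \<rho> by auto
  moreover have "sphere x r \<noteq> {}" using r(1) by simp
  ultimately have "\<exists>z0\<in>sphere x r. \<forall>z\<in>sphere x r. u z0 \<le> u z"
    using cu continuous_on_subset by (intro continuous_attains_inf compact_sphere) blast+
  then obtain z0 where z0: "z0 \<in> sphere x r" "\<And>z. z \<in> sphere x r \<Longrightarrow> u z0 \<le> u z" by blast
  define \<epsilon> where "\<epsilon> = u z0"
  have \<epsilon>: "\<epsilon> > 0"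
    using r1(2)[of z0] z0(1) r \<open>sphere x r \<subseteq> S\<close> by (auto simp: \<epsilon>_def dist_real_def dist_commute)
  let ?q = "\<lambda>z. (z - x) \<bullet> (inv_metric h z *v (z - x))"
  let ?l = "\<lambda>z. (\<Sum>i\<in>UNIV. inv_metric h z $ i $ i) - (\<Sum>k\<in>UNIV. drift h k z * (z - x) $ k)"
  have caK: "continuous_on K (\<lambda>y. inv_metric h y $ i $ j)" and cbK: "continuous_on K (drift h k)"
    for i j k using ca cb KS continuous_on_subset by blast+
  have cx: "continuous_on K (\<lambda>z. (z - x) $ i)" for i by (intro continuous_intros)
  have "continuous_on K ?q"
    unfolding inner_matrix_vector_sum
    by (intro continuous_on_sum continuous_on_mult caK cx)
  from continuous_attains_inf[OF K Kne this]
  obtain z1 where z1: "z1 \<in> K" "\<And>z. z \<in> K \<Longrightarrow> ?q z1 \<le> ?q z" by blast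
  \<comment> \<open>\<open>m\<close> and \<open>B\<close> bound the coefficients of \<open>\<alpha>\<^sup>2\<close> and \<open>\<alpha>\<close> in the Laplacian of the barrier over \<open>K\<close>\<close>
  define m where "m = ?q z1"
  have "z1 \<noteq> x" using z1(1) r by (auto simp: K_def)
  then have m: "m > 0"
    using pos_def_matrix_inv[OF h[of z1]] z1(1) KS
    by (auto simp: m_def pos_def_def inv_metric_def)
  have "continuous_on K (\<lambda>z. \<bar>?l z\<bar>)"
    by (intro continuous_on_rabs continuous_on_diff continuous_on_sum continuous_on_mult caK cbK cx)

  from continuous_attains_sup[OF K Kne this]
  obtain z2 where z2: "\<And>z. z \<in> K \<Longrightarrow> \<bar>?l z\<bar> \<le> \<bar>?l z2\<bar>" by blast
  define B where "B = \<bar>?l z2\<bar>"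
  \<comment> \<open>large enough that \<open>\<kappa> (4 \<alpha>\<^sup>2 m - 2 \<alpha> B) \<ge> 1\<close>, which makes \<open>v\<close> a strict subsolution on \<open>K\<close>\<close>
  define \<alpha> where "\<alpha> = 1 + (B + 1 / \<kappa>) / m"
  have B: "B \<ge> 0" by (simp add: B_def)
  have \<alpha>: "\<alpha> \<ge> 1" "\<alpha> * m \<ge> B + 1 / \<kappa>" using m \<kappa> B by (auto simp: \<alpha>_def field_simps)
  define v where "v z = exp (- \<alpha> * ((z - x) \<bullet> (z - x))) - exp (- \<alpha> * \<rho>\<^sup>2)" for z
  have vy: "v y = 0" by (simp add: v_def \<rho>_def dist_norm dot_square_norm norm_minus_commute)
  have v2: "twice_differentiable_on v S" unfolding v_def by (rule barrier_derivs)
  have dv: "\<kappa> * laplacian h v z < - v z" if z: "z \<in> K" for z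
  proof -
    let ?E = "exp (- \<alpha> * ((z - x) \<bullet> (z - x)))"
    let ?P = "4 * \<alpha>\<^sup>2 * ?q z - 2 * \<alpha> * ?l z"
    have "1 / \<kappa> \<le> 2 * \<alpha> * (\<alpha> * m + (\<alpha> * m - B))"
    proof -
      have "1 / \<kappa> \<le> \<alpha> * m + (\<alpha> * m - B)" using \<alpha> m
        by (smt (verit) mult_nonneg_nonneg)
      also have "\<dots> \<le> 2 * \<alpha> * (\<alpha> * m + (\<alpha> * m - B))"
        using \<alpha> \<kappa> calculation
        by (smt (verit) divide_nonneg_nonneg mult_le_cancel_right1)
      finally show ?thesis .
    qed
    also have "\<dots> = 4 * \<alpha>\<^sup>2 * m - 2 * \<alpha> * B" by (simp add: power2_eq_square algebra_simps)
    also have "\<dots> \<le> ?P"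
    proof -
      have "m \<le> ?q z" using z1(2)[OF z] by (simp add: m_def)
      then have "4 * \<alpha>\<^sup>2 * m \<le> 4 * \<alpha>\<^sup>2 * ?q z" by (intro mult_left_mono) auto
      moreover have "?l z \<le> B" using z2[OF z] by (simp add: B_def)
      then have "2 * \<alpha> * ?l z \<le> 2 * \<alpha> * B" using \<alpha> by (intro mult_left_mono) auto
      ultimately show ?thesis by linarith
    qed
    finally have "1 \<le> \<kappa> * ?P" using \<kappa> by (simp add: field_simps)
    then have "?E * 1 \<le> ?E * (\<kappa> * ?P)" by (intro mult_left_mono) auto
    moreover have "laplacian h v z = - ?E * ?P" unfolding v_def by (rule barrier_derivs)
    then have "\<kappa> * laplacian h v z = - (?E * (\<kappa> * ?P))" by simp
    moreover have "v z < ?E" by (simp add: v_def)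
    ultimately show ?thesis by linarith
  qed
  \<comment> \<open>written as a linear combination to match \<open>laplacian_lincomb\<close>\<close>
  define w where "w z = 1 * u z + (- \<epsilon>) * v z" for z
  have w2: "twice_differentiable_on w S"
    unfolding w_def by (rule twice_differentiable_on_lincomb[OF S u v2])
  then have "continuous_on S w" unfolding twice_differentiable_on_def
    by (meson continuous_at_imp_continuous_on differentiable_imp_continuous_within)
  then have "continuous_on K w" using KS continuous_on_subset by blast
  from continuous_attains_inf[OF K Kne this]
  obtain z where z: "z \<in> K" "\<And>z'. z' \<in> K \<Longrightarrow> w z \<le> w z'" by blast
  have wz: "w z \<le> 0" using z(2)[OF yK] uy vy by (simp add: w_def)
  have "dist x z \<noteq> r"
  proof
    assume "dist x z = r"
    then have "\<epsilon> \<le> u z" using z0(2) by (simp add: \<epsilon>_def)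
    moreover have "exp (- \<alpha> * ((z - x) \<bullet> (z - x))) \<le> 1" using \<alpha>(1) by simp
    then have "v z < 1" unfolding v_def using exp_gt_zero[of "- \<alpha> * \<rho>\<^sup>2"] by linarith
    ultimately show False using wz \<epsilon> unfolding w_def
      by (smt (verit) mult_less_cancel_left2 mult_minus_left)
  qed
  moreover have "dist x z \<noteq> R"
  proof
    assume "dist x z = R"
    then have "(z - x) \<bullet> (z - x) = R\<^sup>2"
      by (simp add: dist_norm dot_square_norm norm_minus_commute)
    moreover have "\<rho>\<^sup>2 < R\<^sup>2" using \<rho> by (simp add: power_strict_mono)
    ultimately have "v z < 0" using \<alpha>(1) by (simp add: v_def)
    then have "\<epsilon> * v z < 0" using \<epsilon> by (simp add: mult_pos_neg)
    moreover have "u z \<ge> 0" using nonneg z(1) KS by auto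
    ultimately show False using wz by (simp add: w_def)
  qed
  ultimately have zU: "z \<in> ball x R - cball x r" using z(1) by (auto simp: K_def)
  have US: "ball x R - cball x r \<subseteq> K" by (auto simp: K_def)
  have zS: "z \<in> S" using z(1) KS by auto
  have "laplacian h w z \<le> 0"
  proof (rule laplacian_local_min_le_0[where S="ball x R - cball x r"])
    show "twice_differentiable_on w (ball x R - cball x r)"
      using w2 US KS unfolding twice_differentiable_on_def by blast
  qed (use zU z US h zS in auto)
  have "laplacian h w z = laplacian h u z - \<epsilon> * laplacian h v z"
    unfolding w_def laplacian_lincomb[OF S u v2 zS] by simp
  then have "\<kappa> * laplacian h w z = \<kappa> * laplacian h u z - \<epsilon> * (\<kappa> * laplacian h v z)"
    by (simp only: right_diff_distrib) (simp add: mult_ac)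
  moreover have "\<epsilon> * (\<kappa> * laplacian h v z) < \<epsilon> * (- v z)"
    using dv[OF z(1)] \<epsilon> by (rule mult_strict_left_mono)
  moreover have "- u z \<le> \<kappa> * laplacian h u z" using super[OF zS] by linarith
  ultimately have "0 < \<kappa> * laplacian h w z" using wz
    by (simp add: w_def)
  then show False using \<open>laplacian h w z \<le> 0\<close> \<kappa> by (simp add: zero_less_mult_iff)
qed

section \<open>Regularity of the coefficients\<close>

lemma smooth_on_continuous: "smooth_on S f \<Longrightarrow> continuous_on S f"
  unfolding smooth_on_def by (metis C_k_on.simps(1))

lemma smooth_on_frechet_derivative:
  "smooth_on S f \<Longrightarrow> smooth_on S (\<lambda>x. frechet_derivative f (at x) v)"
  unfolding smooth_on_def by (metis C_k_on.simps(2))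

lemma smooth_on_differentiable: "smooth_on S f \<Longrightarrow> x \<in> S \<Longrightarrow> f differentiable at x"
  unfolding smooth_on_def by (metis C_k_on.simps(2))

lemma smooth_on_imp_twice_differentiable_on:
  fixes f :: "real^'n::finite \<Rightarrow> real"
  assumes "smooth_on S f"
  shows "twice_differentiable_on f S"
proof -
  have "pderiv_at i f = (\<lambda>x. frechet_derivative f (at x) (axis i 1))" for i
    by (simp add: fun_eq_iff pderiv_at_def)
  then show ?thesis
    using smooth_on_differentiable[OF assms]
      smooth_on_differentiable[OF smooth_on_frechet_derivative[OF assms]]
    by (simp add: twice_differentiable_on_def)
qed

lemma continuous_on_entry:
  fixes F :: "real^'n::finite \<Rightarrow> real^'n^'n"
  shows "continuous_on S F \<Longrightarrow> continuous_on S (\<lambda>y. F y $ i $ j)"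
  by (intro continuous_on_component)

lemma continuous_on_pderiv_metric:
  fixes h :: "'n::finite matrix_field"
  assumes h: "smooth_on S h"
  shows "continuous_on S (pderiv_at i (\<lambda>z. h z $ j $ l))"
proof -
  have "pderiv_at i (\<lambda>z. h z $ j $ l) y = frechet_derivative h (at y) (axis i 1) $ j $ l"
    if "y \<in> S" for y
  proof -
    have "(h has_derivative frechet_derivative h (at y)) (at y)"
      using smooth_on_differentiable[OF h that] frechet_derivative_works by blast
    then have "((\<lambda>z. h z $ j $ l) has_derivative (\<lambda>v. frechet_derivative h (at y) v $ j $ l)) (at y)"
      by (intro bounded_linear.has_derivative[OF bounded_linear_vec_nth])
    then show ?thesis by (rule pderiv_at_eqI)
  qed
  moreover have "continuous_on S (\<lambda>y. frechet_derivative h (at y) (axis i 1) $ j $ l)"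
    by (intro continuous_on_entry smooth_on_continuous smooth_on_frechet_derivative h)
  ultimately show ?thesis by (simp cong: continuous_on_cong)
qed

lemma
  fixes h :: "'n::finite matrix_field"
  assumes h: "smooth_on S h" and p: "\<And>y. y \<in> S \<Longrightarrow> pos_def (h y)"
  shows continuous_on_inv_metric: "continuous_on S (\<lambda>y. inv_metric h y $ i $ j)"
    and continuous_on_drift: "continuous_on S (drift h k)"
proof -
  show a: "continuous_on S (\<lambda>y. inv_metric h y $ i $ j)" for i j
    unfolding inv_metric_def
    by (rule continuous_on_matrix_inv[OF continuous_on_entry[OF smooth_on_continuous[OF h]] p])
  have "continuous_on S (christoffel h k i j)" for k i j
    unfolding christoffel_def
    by (intro continuous_on_mult continuous_on_const continuous_on_sum continuous_on_add
        continuous_on_diff a continuous_on_pderiv_metric[OF h])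
  then show "continuous_on S (drift h k)"
    unfolding drift_def by (intro continuous_on_mult continuous_on_sum a)
qed

section \<open>The norm of a tensor\<close>

text \<open>With \<open>P\<close> the inverse metric, the squared norm of \<open>T\<close> is the contraction of \<open>P\<close> with
\<open>H = T P T\<^sup>T\<close>.  The diagonal entries of \<open>H\<close> are the \<open>P\<close>-square-lengths of the rows of \<open>T\<close>, so all
rows vanish.\<close>

lemma tensor_norm_eq_0_imp:
  fixes h T :: "'n::finite matrix_field"
  assumes h: "pos_def (h y)" and z: "tensor_norm h T y = 0"
  shows "T y = 0"
proof -
  let ?P = "inv_metric h y" and ?T = "T y"
  define H where "H = ?T ** ?P ** transpose ?T"
  have P: "pos_def ?P" using pos_def_matrix_inv[OF h] by (simp add: inv_metric_def)
  have H: "x \<bullet> (H *v x) = (x v* ?T) \<bullet> (?P *v (x v* ?T))" for x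
    by (simp add: H_def matrix_vector_mul_assoc[symmetric] dot_lmul_matrix)
  have "frobenius ?P H = (\<Sum>i\<in>UNIV. \<Sum>j\<in>UNIV. \<Sum>k\<in>UNIV. \<Sum>l\<in>UNIV.
      ?P $ i $ k * ?P $ j $ l * ?T $ i $ j * ?T $ k $ l)"
  proof -
    have "(\<Sum>k\<in>UNIV. ?P $ i $ k * H $ i $ k) = (\<Sum>j\<in>UNIV. \<Sum>k\<in>UNIV. \<Sum>l\<in>UNIV.
      ?P $ i $ k * ?P $ j $ l * ?T $ i $ j * ?T $ k $ l)" for i
    proof -
      have "?P $ i $ k * H $ i $ k = (\<Sum>j\<in>UNIV. \<Sum>l\<in>UNIV.
          ?P $ i $ k * ?P $ j $ l * ?T $ i $ j * ?T $ k $ l)" for k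
        unfolding H_def matrix_matrix_mult_def transpose_def
        by (subst sum.swap) (simp add: sum_distrib_left sum_distrib_right mult_ac)
      then show ?thesis by (simp only:) (rule sum.swap)
    qed
    then show ?thesis by (simp add: frobenius_def)
  qed
  then have "frobenius ?P H = 0" using z by (simp add: tensor_norm_def)
  moreover have "x \<bullet> (H *v x) \<ge> 0" for x
    using P unfolding H pos_def_def by (cases "x v* ?T = 0") (auto intro: less_imp_le)
  ultimately have "H $ i $ i = 0" for i using frobenius_zero_imp[OF P] by blast
  then have "(axis i 1 v* ?T) \<bullet> (?P *v (axis i 1 v* ?T)) = 0" for i
    by (simp add: H[symmetric] axis_inner_matrix_axis)
  then have "axis i 1 v* ?T = 0" for i
    using P unfolding pos_def_def by (metis less_irrefl)
  moreover have "(axis i 1 v* ?T) $ j = ?T $ i $ j" for i j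
    by (simp add: vector_matrix_mult_def axis_def if_distrib if_distribR cong: if_cong)
  ultimately show ?thesis by (simp add: vec_eq_iff)
qed

section \<open>Maximum principles on the manifold\<close>

definition twice_differentiable_function :: "('m, 'n::finite) chart set \<Rightarrow> ('m \<Rightarrow> real) \<Rightarrow> bool" where
  "twice_differentiable_function A p \<longleftrightarrow> (\<forall>c\<in>A. twice_differentiable_on (in_chart c p) (chart_range c))"

definition supersolution ::
    "('m, 'n::finite) chart set \<Rightarrow> ('m, 'n) tensor2 \<Rightarrow> real \<Rightarrow> ('m \<Rightarrow> real) \<Rightarrow> bool" where
  "supersolution A g \<kappa> p \<longleftrightarrow>
     (\<forall>c\<in>A. \<forall>y\<in>chart_range c. \<kappa> * laplacian (g c) (in_chart c p) y + in_chart c p y \<ge> 0)"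

lemma
  assumes M: "smooth_manifold M A" and c: "c \<in> A"
  shows chart_open_range: "open (chart_range c)"
    and chart_open_domain: "openin M (fst c)"
    and chart_homeomorphic:
      "homeomorphic_map (subtopology M (fst c)) (top_of_set (chart_range c)) (snd c)"
    and chart_inv_snd: "x \<in> fst c \<Longrightarrow> chart_inv c (snd c x) = x"
    and chart_inv_domain: "y \<in> chart_range c \<Longrightarrow> chart_inv c y \<in> topspace M"
proof -
  have ch: "is_chart M c" using M c by (simp add: smooth_manifold_def)
  then show "open (chart_range c)" and o: "openin M (fst c)"
    and hom: "homeomorphic_map (subtopology M (fst c)) (top_of_set (chart_range c)) (snd c)"
    by (simp_all add: is_chart_def)
  have "topspace (subtopology M (fst c)) = fst c" using openin_subset[OF o] by auto
  then have "inj_on (snd c) (fst c)" using homeomorphic_imp_injective_map[OF hom] by simp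
  then show "x \<in> fst c \<Longrightarrow> chart_inv c (snd c x) = x" by (simp add: chart_inv_def)
  show "y \<in> chart_range c \<Longrightarrow> chart_inv c y \<in> topspace M"
    using openin_subset[OF o] unfolding chart_inv_def chart_range_def
    by (meson inv_into_into subsetD)
qed

lemma obtain_chart:
  assumes "smooth_manifold M A" "x \<in> topspace M"
  obtains c where "c \<in> A" "x \<in> fst c" "snd c x \<in> chart_range c"
proof -
  obtain c where "c \<in> A" "x \<in> fst c" using assms unfolding smooth_manifold_def by blast
  then show thesis using that by (simp add: chart_range_def)
qed

lemma twice_differentiable_function_continuous:
  assumes M: "smooth_manifold M A" and p: "twice_differentiable_function A p"
  shows "continuous_map M euclideanreal p"
proof (rule pasting_lemma[where I = A and T = fst and f = "\<lambda>_. p"])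
  fix c assume c: "c \<in> A"
  show "openin M (fst c)" by (rule chart_open_domain[OF M c])
  have "continuous_on (chart_range c) (in_chart c p)"
    using p c unfolding twice_differentiable_function_def twice_differentiable_on_def
    by (meson continuous_at_imp_continuous_on differentiable_imp_continuous_within)
  then have "continuous_map (subtopology M (fst c)) euclideanreal (in_chart c p \<circ> snd c)"
    by (intro continuous_map_compose[OF homeomorphic_imp_continuous_map[OF chart_homeomorphic[OF M c]]])
      simp
  moreover have "(in_chart c p \<circ> snd c) x = p x"
    if "x \<in> topspace (subtopology M (fst c))" for x
    using that by (simp add: in_chart_def chart_inv_snd[OF M c])
  ultimately show "continuous_map (subtopology M (fst c)) euclideanreal p"
    by (rule continuous_map_eq)
next
  show "\<exists>j. j \<in> A \<and> x \<in> fst j \<and> p x = p x" if "x \<in> topspace M" for x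
    using obtain_chart[OF M that] by metis
qed auto

lemma riemannian_metric_pos_def:
  assumes "riemannian_metric A g" "c \<in> A" "y \<in> chart_range c"
  shows "pos_def (g c y)"
  using assms by (simp add: riemannian_metric_def pos_def_def)

lemma weak_maximum_principle:
  assumes M: "smooth_manifold M A" and compact: "compact_space M"
    and g: "riemannian_metric A g" and p: "twice_differentiable_function A p"
    and \<kappa>: "\<kappa> > 0" and super: "supersolution A g \<kappa> p" and x: "x \<in> topspace M"
  shows "p x \<ge> 0"
proof -
  have "compactin euclideanreal (p ` topspace M)"
    using compact twice_differentiable_function_continuous[OF M p] unfolding compact_space_def
    by (rule image_compactin)
  then have "compact (p ` topspace M)" by simp
  moreover have "p ` topspace M \<noteq> {}" using x by blast
  ultimately obtain x0 where x0: "x0 \<in> topspace M" "\<And>x. x \<in> topspace M \<Longrightarrow> p x0 \<le> p x"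
    using compact_attains_inf[of "p ` topspace M"] by auto
  obtain c where c: "c \<in> A" "x0 \<in> fst c" and y: "snd c x0 \<in> chart_range c"
    using obtain_chart[OF M x0(1)] .
  let ?u = "in_chart c p"
  have u0: "?u (snd c x0) = p x0" using c by (simp add: in_chart_def chart_inv_snd[OF M])
  have "laplacian (g c) ?u (snd c x0) \<le> 0"
  proof (rule laplacian_local_min_le_0[OF chart_open_range[OF M c(1)] y])
    show "twice_differentiable_on ?u (chart_range c)" using p c by (simp add: twice_differentiable_function_def)
    show "?u (snd c x0) \<le> ?u z" if "z \<in> chart_range c" for z
      using x0(2)[OF chart_inv_domain[OF M c(1) that]] by (simp add: u0) (simp add: in_chart_def)
    show "pos_def (g c (snd c x0))" by (rule riemannian_metric_pos_def[OF g c(1) y])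
  qed
  then have "\<kappa> * laplacian (g c) ?u (snd c x0) \<le> 0" using \<kappa> by (simp add: mult_nonneg_nonpos)
  then have "p x0 \<ge> 0" using super c y u0 unfolding supersolution_def by fastforce
  then show ?thesis using x0(2)[OF x] by linarith
qed

text \<open>If \<open>u\<close> vanishes at the centre of a coordinate ball of radius \<open>e\<close> and \<open>z\<close> lies within \<open>e / 3\<close> of the
centre, then the ball of radius \<open>e / 3\<close> about \<open>z\<close> still lies in the chart and contains that centre.
So \<open>u z > 0\<close> would make \<open>u\<close> positive at the centre.\<close>

lemma zero_set_open:
  assumes M: "smooth_manifold M A" and g: "riemannian_metric A g" and p: "twice_differentiable_function A p"
    and \<kappa>: "\<kappa> > 0" and super: "supersolution A g \<kappa> p"
    and nonneg: "\<And>x. x \<in> topspace M \<Longrightarrow> p x \<ge> 0"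
  shows "openin M {x \<in> topspace M. p x = 0}"
proof (subst openin_subopen, intro ballI)
  fix x assume "x \<in> {x \<in> topspace M. p x = 0}"
  then have x: "x \<in> topspace M" "p x = 0" by auto
  obtain c where c: "c \<in> A" "x \<in> fst c" and y: "snd c x \<in> chart_range c"
    using obtain_chart[OF M x(1)] .
  let ?S = "chart_range c" and ?u = "in_chart c p" and ?y = "snd c x"
  note S = chart_open_range[OF M c(1)]
  have pd: "pos_def (g c z)" if "z \<in> ?S" for z by (rule riemannian_metric_pos_def[OF g c(1) that])
  have sm: "smooth_on ?S (g c)"
    using g c unfolding riemannian_metric_def smooth_tensor2_def by blast
  have un: "?u z \<ge> 0" if "z \<in> ?S" for z
    using nonneg[OF chart_inv_domain[OF M c(1) that]] by (simp add: in_chart_def)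
  have u0: "?u ?y = 0" using c x by (simp add: in_chart_def chart_inv_snd[OF M])
  obtain e where e: "e > 0" "ball ?y e \<subseteq> ?S" using S y open_contains_ball by blast
  have zero: "?u z = 0" if z: "dist ?y z < e / 3" for z
  proof (rule ccontr)
    assume nz: "?u z \<noteq> 0"
    have sub: "cball z (e / 3) \<subseteq> ?S"
    proof
      fix w assume "w \<in> cball z (e / 3)"
      then have "dist ?y w < e" using z e(1) dist_triangle[of ?y w z] by simp
      then show "w \<in> ?S" using e(2) by auto
    qed
    have "z \<in> ?S" using sub e(1) by auto
    then have "?u z > 0" using un[of z] nz by linarith
    have "?u ?y > 0"
    proof (rule strong_maximum_principle_ball[where S = ?S and h = "g c" and x = z and R = "e / 3"])
      show "twice_differentiable_on ?u ?S" using p c(1) by (simp add: twice_differentiable_function_def)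
      show "\<kappa> * laplacian (g c) ?u w + ?u w \<ge> 0" if "w \<in> ?S" for w
        using super c(1) that by (simp add: supersolution_def)
      show "continuous_on ?S (\<lambda>y. inv_metric (g c) y $ i $ j)" for i j
        by (rule continuous_on_inv_metric[OF sm pd])
      show "continuous_on ?S (drift (g c) k)" for k
        by (rule continuous_on_drift[OF sm pd])
      show "?y \<in> ball z (e / 3)" using z by (simp add: dist_commute)
    qed (fact S pd un \<kappa> sub \<open>?u z > 0\<close>)+
    then show False using u0 by simp
  qed
  let ?V = "{x' \<in> topspace (subtopology M (fst c)). snd c x' \<in> ball ?y (e / 3) \<inter> ?S}"
  have "openin (top_of_set ?S) (ball ?y (e / 3) \<inter> ?S)" using S by (simp add: openin_open_eq open_Int)
  then have "openin (subtopology M (fst c)) ?V"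
    by (rule openin_continuous_map_preimage[OF
          homeomorphic_imp_continuous_map[OF chart_homeomorphic[OF M c(1)]]])
  then have "openin M ?V" using chart_open_domain[OF M c(1)] openin_trans_full by blast
  moreover have "x \<in> ?V" using x c y e(1) by simp
  moreover have "?V \<subseteq> {x \<in> topspace M. p x = 0}"
  proof
    fix x' assume x': "x' \<in> ?V"
    then have "?u (snd c x') = p x'" by (simp add: in_chart_def chart_inv_snd[OF M c(1)])
    then show "x' \<in> {x \<in> topspace M. p x = 0}" using x' zero[of "snd c x'"] by auto
  qed
  ultimately show "\<exists>T. openin M T \<and> x \<in> T \<and> T \<subseteq> {x \<in> topspace M. p x = 0}" by blast
qed

lemma strong_maximum_principle:
  assumes M: "smooth_manifold M A" and conn: "connected_space M"
    and g: "riemannian_metric A g" and p: "twice_differentiable_function A p"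
    and \<kappa>: "\<kappa> > 0" and super: "supersolution A g \<kappa> p"
    and nonneg: "\<And>x. x \<in> topspace M \<Longrightarrow> p x \<ge> 0"
  shows "(\<forall>x\<in>topspace M. p x = 0) \<or> (\<forall>x\<in>topspace M. p x > 0)"
proof -
  have "closedin M {x \<in> topspace M. p x \<in> {0}}"
    by (rule closedin_continuous_map_preimage[OF twice_differentiable_function_continuous[OF M p]]) simp
  then have "closedin M {x \<in> topspace M. p x = 0}" by simp
  moreover have "openin M {x \<in> topspace M. p x = 0}"
    using zero_set_open[OF M g p \<kappa> super nonneg] .
  ultimately have "{x \<in> topspace M. p x = 0} = {} \<or> {x \<in> topspace M. p x = 0} = topspace M"
    using conn unfolding connected_space_clopen_in by blast
  then show ?thesis using nonneg by (force simp: less_le)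
qed

lemma homogeneous_solution_zero:
  assumes M: "smooth_manifold M A" and compact: "compact_space M"
    and g: "riemannian_metric A g" and p: "twice_differentiable_function A p" and \<kappa>: "\<kappa> > 0"
    and eq: "\<And>c y. c \<in> A \<Longrightarrow> y \<in> chart_range c \<Longrightarrow>
      \<kappa> * laplacian (g c) (in_chart c p) y + in_chart c p y = 0"
    and x: "x \<in> topspace M"
  shows "p x = 0"
proof -
  let ?q = "\<lambda>x. - p x"
  \<comment> \<open>the form to which the lemmas on linear combinations apply\<close>
  have q: "in_chart c ?q = (\<lambda>z. (- 1) * in_chart c p z + 0 * in_chart c p z)" for c :: "('a, 'b) chart"
    by (simp add: in_chart_def fun_eq_iff)
  have "twice_differentiable_function A ?q"
    unfolding twice_differentiable_function_def q
  proof (intro ballI)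
    fix c assume c: "c \<in> A"
    then have u: "twice_differentiable_on (in_chart c p) (chart_range c)"
      using p by (simp add: twice_differentiable_function_def)
    show "twice_differentiable_on (\<lambda>z. (- 1) * in_chart c p z + 0 * in_chart c p z) (chart_range c)"
      by (rule twice_differentiable_on_lincomb[OF chart_open_range[OF M c] u u])
  qed
  moreover have "supersolution A g \<kappa> ?q"
    unfolding supersolution_def q
  proof (intro ballI)
    fix c y assume c: "c \<in> A" "y \<in> chart_range c"
    then have u: "twice_differentiable_on (in_chart c p) (chart_range c)"
      using p by (simp add: twice_differentiable_function_def)
    show "0 \<le> \<kappa> * laplacian (g c) (\<lambda>z. (- 1) * in_chart c p z + 0 * in_chart c p z) y
        + ((- 1) * in_chart c p y + 0 * in_chart c p y)"
      unfolding laplacian_lincomb[OF chart_open_range[OF M c(1)] u u c(2)]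
      using eq[OF c] by simp
  qed
  ultimately have "?q x \<ge> 0" by (rule weak_maximum_principle[OF M compact g _ \<kappa> _ x])
  moreover have "p x \<ge> 0"
    using eq by (intro weak_maximum_principle[OF M compact g p \<kappa> _ x]) (simp add: supersolution_def)
  ultimately show ?thesis by simp
qed

theorem proposition3p3:
  fixes M :: "'m topology"
    and A :: "('m, 'n::finite) chart set"
    and g :: "('m, 'n) tensor2"
    and p :: "'m \<Rightarrow> real"
  assumes "smooth_manifold M A" and "oriented_atlas A"
    and "compact_space M" and "connected_space M"
    and "CARD('n) \<ge> 3"
    and "g \<in> metrics_scal_minus_one A"
    and "smooth_function A p"
    and "\<forall>c\<in>A. \<forall>y\<in>chart_range c.
           (real CARD('n) - 1) * laplacian (g c) (in_chart c p) y + in_chart c p y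
             = 2 * (tensor_norm (g c) (traceless_ricci (g c)) y)\<^sup>2"
  shows "(\<forall>x\<in>topspace M. p x \<ge> 0) \<and>
    ((\<forall>x\<in>topspace M. p x = 0) \<and>
       tensor2_eq A (\<lambda>c. ricci (g c)) (\<lambda>c y. - (1 / real CARD('n)) *\<^sub>R g c y)
     \<or> (\<forall>x\<in>topspace M. p x > 0) \<and>
       \<not> tensor2_eq A (\<lambda>c. ricci (g c)) (\<lambda>c y. - (1 / real CARD('n)) *\<^sub>R g c y))"
proof -
  note M = assms(1) and compact = assms(3) and conn = assms(4) and eq = assms(8)
  define \<kappa> where "\<kappa> = real CARD('n) - 1"
  have \<kappa>: "\<kappa> > 0" using assms(5) by (simp add: \<kappa>_def)
  have g: "riemannian_metric A g"
    and R: "\<And>c y. c \<in> A \<Longrightarrow> y \<in> chart_range c \<Longrightarrow> scalar_curvature (g c) y = -1"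
    using assms(6) by (auto simp: metrics_scal_minus_one_def)
  have p: "twice_differentiable_function A p"
    using assms(7) smooth_on_imp_twice_differentiable_on
    by (auto simp: smooth_function_def twice_differentiable_function_def)
  have super: "supersolution A g \<kappa> p" using eq by (simp add: supersolution_def \<kappa>_def)
  have nonneg: "p x \<ge> 0" if "x \<in> topspace M" for x
    by (rule weak_maximum_principle[OF M compact g p \<kappa> super that])
  let ?einstein = "tensor2_eq A (\<lambda>c. ricci (g c)) (\<lambda>c y. - (1 / real CARD('n)) *\<^sub>R g c y)"
  have einstein_iff: "?einstein \<longleftrightarrow> (\<forall>c\<in>A. \<forall>y\<in>chart_range c. traceless_ricci (g c) y = 0)"
    by (simp add: tensor2_eq_def traceless_ricci_def R eq_neg_iff_add_eq_0)
  have zero: "\<forall>x\<in>topspace M. p x = 0" if "?einstein"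
  proof
    fix x assume x: "x \<in> topspace M"
    show "p x = 0"
    proof (rule homogeneous_solution_zero[OF M compact g p \<kappa> _ x])
      fix c y assume c: "c \<in> A" "y \<in> chart_range c"
      then have "traceless_ricci (g c) y = 0" using that einstein_iff by blast
      then have "tensor_norm (g c) (traceless_ricci (g c)) y = 0" by (simp add: tensor_norm_def)
      then show "\<kappa> * laplacian (g c) (in_chart c p) y + in_chart c p y = 0"
        using eq c by (simp add: \<kappa>_def)
    qed
  qed
  have einstein: "?einstein" if z: "\<forall>x\<in>topspace M. p x = 0"
    unfolding einstein_iff
  proof (intro ballI)
    fix c y assume c: "c \<in> A" "y \<in> chart_range c"
    have u: "in_chart c p z = 0" if "z \<in> chart_range c" for z
      using chart_inv_domain[OF M c(1) that] z by (simp add: in_chart_def)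
    have pd: "pos_def (g c y)" by (rule riemannian_metric_pos_def[OF g c])
    have "laplacian (g c) (in_chart c p) y \<le> 0"
    proof (rule laplacian_local_min_le_0[OF chart_open_range[OF M c(1)] c(2)])
      show "twice_differentiable_on (in_chart c p) (chart_range c)"
        using p c by (simp add: twice_differentiable_function_def)
    qed (simp_all add: u c pd)
    then have "\<kappa> * laplacian (g c) (in_chart c p) y \<le> 0"
      using \<kappa> by (simp add: mult_nonneg_nonpos)
    then have "2 * (tensor_norm (g c) (traceless_ricci (g c)) y)\<^sup>2 \<le> 0"
      using bspec[OF bspec[OF eq c(1)] c(2)] u[OF c(2)] unfolding \<kappa>_def by linarith
    then have "tensor_norm (g c) (traceless_ricci (g c)) y = 0" by simp
    then show "traceless_ricci (g c) y = 0"
      using tensor_norm_eq_0_imp[of "g c" y "traceless_ricci (g c)"] pd by blast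
  qed
  show ?thesis
    using nonneg strong_maximum_principle[OF M conn g p \<kappa> super nonneg] zero einstein
    by (meson less_irrefl)
qed

end
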